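(* Let $T$ be the infinite rooted binary tree and let $w(t)=(1+|t|)^{-2}$ for $t\in T$. Consider the linear operator $\mathcal{V}:\ell_2(T,W)\to\ell_\infty(T)$ defined by $$(\mathcal{V}f)(t)=\sum_{u\preceq t}w(u)f(u),\qquad t\in T,$$ and its dual $\mathcal{V}^*:\ell_1(T)\to\ell_2(T,W)$ defined by $$(\mathcal{V}^*\mu)(t)=\sum_{u\succeq t}\mu(u),\qquad t\in T.$$ There exists a numerical constant $C$ such that for all positive integers $n$ $$\max\{e_n(\mathcal{V}),\,e_n(\mathcal{V}^* )\}\le \frac{C}{\sqrt n}.$$
   Context: Binary tree: $T$ has levels $T_0,T_1,T_2,\dots$; $T_0$ consists of the single root, and every node of $T_l$ has exactly two direct offsprings, all of which together form $T_{l+1}$ (so $|T_l|=2^l$). Write $|t|=l$ if $t\in T_l$. Write $u\succeq t$ (equivalently $t\preceq u$) if $u=t$ or $u$ is a direct or indirect offspring of $t$. Spaces: $\ell_1(T)$ is the space of real functions $\mu$ on $T$ with $\|\mu\|_1=\sum_{t\in T}|\mu(t)|<\infty$; $\ell_\infty(T)$ is the space of bounded real functions on $T$ with the supremum norm. For the weight $W=\{w(t)\}_{t\in T}$, $\ell_2(T,W)$ is the space of real functions $f$ on $T$ with norm $\|f\|_{2,W}=\left(\sum_{t\in T}w(t)|f(t)|^2\right)^{1/2}<\infty$. Entropy numbers: for a set $A$ in a metric space, the $n$-th dyadic entropy number $e_n(A)$ is the infimum of $\varepsilon>0$ such that $A$ admits a covering by $2^{n-1}$ balls of radius $\varepsilon$.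 For a linear operator $V:X\to Y$ between normed spaces, $e_n(V)$ is the $n$-th entropy number of the image under $V$ of the unit ball of $X$, as a subset of $Y$. *)

theory Defs
  imports "HOL-Analysis.Analysis" "HOL-Library.Sublist"
begin

text \<open>
  A node of the infinite binary tree is encoded by the path leading to it from the root: the root
  is \<open>[]\<close>, the direct offspring of \<open>t\<close> are \<open>t @ [False]\<close> and \<open>t @ [True]\<close>, the level of \<open>t\<close> is
  \<open>length t\<close>, and \<open>u\<close> lies on the path from the root to \<open>t\<close> iff \<open>prefix u t\<close>.
\<close>

type_synonym node = "bool list"

definition l1_space :: "(node \<Rightarrow> real) set" where
  "l1_space = {\<mu>. (\<lambda>t. \<bar>\<mu> t\<bar>) summable_on UNIV}"

definition l1_norm :: "(node \<Rightarrow> real) \<Rightarrow> real" where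
  "l1_norm \<mu> = (\<Sum>\<^sub>\<infinity>t. \<bar>\<mu> t\<bar>)"

definition linf_space :: "(node \<Rightarrow> real) set" where
  "linf_space = {f. bounded (range f)}"

definition linf_norm :: "(node \<Rightarrow> real) \<Rightarrow> real" where
  "linf_norm f = (SUP t. \<bar>f t\<bar>)"

definition l2_space :: "(node \<Rightarrow> real) \<Rightarrow> (node \<Rightarrow> real) set" where
  "l2_space w = {f. (\<lambda>t. w t * \<bar>f t\<bar>\<^sup>2) summable_on UNIV}"

definition l2_norm :: "(node \<Rightarrow> real) \<Rightarrow> (node \<Rightarrow> real) \<Rightarrow> real" where
  "l2_norm w f = sqrt (\<Sum>\<^sub>\<infinity>t. w t * \<bar>f t\<bar>\<^sup>2)"

definition tree_weight :: "node \<Rightarrow> real" where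
  "tree_weight t = 1 / (1 + real (length t))\<^sup>2"

text \<open>
  The entropy number is an extended real, so that it is \<open>\<infinity>\<close> (rather than an unspecified real)
  when no covering exists. The centres range over the whole metric space \<open>M\<close>, and only points
  of \<open>M\<close> can be covered. The ball is written out instead of using \<open>Metric_space.mcball\<close>, whose
  characterization requires symmetry and nonnegativity of \<open>d\<close> outside \<open>M\<close> as well; the supremum
  norm has no specified value at unbounded functions.
\<close>

definition entropy_number ::
    "'a set \<Rightarrow> ('a \<Rightarrow> 'a \<Rightarrow> real) \<Rightarrow> nat \<Rightarrow> 'a set \<Rightarrow> ereal" where
  "entropy_number M d n A =
     Inf {ereal \<epsilon> | \<epsilon>. \<epsilon> > 0 \<and>
       (\<exists>S. S \<subseteq> M \<and> finite S \<and> card S \<le> 2 ^ (n - 1) \<and>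
          A \<subseteq> (\<Union>c\<in>S. {y \<in> M. d c y \<le> \<epsilon>}))}"

text \<open>
  Normed spaces of functions are given by a carrier and a norm. The operator is not assumed to
  map \<open>X\<close> into \<open>Y\<close>: the value is \<open>\<infinity>\<close> if the image of the unit ball leaves \<open>Y\<close>.
\<close>

definition operator_entropy_number ::
    "('a \<Rightarrow> real) set \<Rightarrow> (('a \<Rightarrow> real) \<Rightarrow> real) \<Rightarrow>
     ('b \<Rightarrow> real) set \<Rightarrow> (('b \<Rightarrow> real) \<Rightarrow> real) \<Rightarrow>
     nat \<Rightarrow> (('a \<Rightarrow> real) \<Rightarrow> ('b \<Rightarrow> real)) \<Rightarrow> ereal" where
  "operator_entropy_number X normX Y normY n V =
     entropy_number Y (\<lambda>f g. normY (\<lambda>t. f t - g t)) n (V ` {f \<in> X. normX f \<le> 1})"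

definition summation_op :: "(node \<Rightarrow> real) \<Rightarrow> (node \<Rightarrow> real) \<Rightarrow> node \<Rightarrow> real" where
  "summation_op w f t = (\<Sum>u | prefix u t. w u * f u)"

definition dual_summation_op :: "(node \<Rightarrow> real) \<Rightarrow> node \<Rightarrow> real" where
  "dual_summation_op \<mu> t = (\<Sum>\<^sub>\<infinity>u | prefix t u. \<mu> u)"

end

theory Submission
  imports Defs
begin

text \<open>
  For the dual operator one may assume \<open>\<mu> \<ge> 0\<close> and \<open>\<parallel>\<mu>\<parallel>\<^sub>1 \<le> 1\<close>. Round the mass \<open>m t\<close> of the subtree at
  \<open>t\<close> down to a multiple \<open>k t\<close> of \<open>(1 + |t|) / N\<close>. The threshold increases with the level while the mass
  decreases along paths, so the nodes with \<open>k t > 0\<close> form a subtree, and integrating along paths with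
  respect to \<open>\<mu>\<close> shows both that the sum of \<open>sqrt (k t)\<close> is at most \<open>2 N\<close> and that the squared error
  is at most \<open>4 / N\<close>. A generating function argument bounds the number of such labelled subtrees by
  \<open>2 exp (8 N)\<close>, whence \<open>e\<^sub>n(V\<^sup>*) = O(n\<^sup>-\<^sup>1\<^sup>/\<^sup>2)\<close>.

  The bound passes to the operator itself by duality of covering numbers. With covering numbers
  \<open>N(\<rho>)\<close> of the operator and \<open>M(\<rho>)\<close> of its dual, \<open>N(\<rho>) \<le> M(\<rho> / 8) N(2 \<rho>)\<close>, and iterating this
  inequality yields a geometric sum.
\<close>

subsection \<open>Path sums and the energy norm\<close>

text \<open>The term at level \<open>L\<close> is at most \<open>1 / (1 + L)\<close>, and the later
  terms telescope to at most the same value; this gives the factor 2.\<close>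

lemma sum_inverse_squares_le:
  fixes I :: "nat set"
  assumes "finite I" "\<And>l. l \<in> I \<Longrightarrow> L \<le> l"
  shows "(\<Sum>l\<in>I. 1 / (1 + real l)\<^sup>2) \<le> 2 / (1 + real L)"
proof -
  have telescope:
    "(\<Sum>l=L..L+n. 1 / (1 + real l)\<^sup>2) \<le> 2 / (1 + real L) - 1 / (1 + real (L + n))" for n
  proof (induction n)
    case 0
    have "1 / (1 + real L)\<^sup>2 \<le> 1 / (1 + real L)"
      by (rule divide_left_mono) (auto intro!: self_le_power mult_pos_pos add_pos_nonneg)
    then show ?case by simp
  next
    case (Suc n)
    have "1 / (2 + real (L + n))\<^sup>2 \<le> 1 / (1 + real (L + n)) - 1 / (2 + real (L + n))"
      by (simp add: divide_simps power2_eq_square add_pos_nonneg)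
    then show ?case using Suc by (simp add: add_ac)
  qed
  obtain b where "\<forall>l\<in>I. l \<le> b" using assms(1) finite_nat_set_iff_bounded_le by blast
  then have "I \<subseteq> {L..L+b}" using assms(2) by fastforce
  then have "(\<Sum>l\<in>I. 1 / (1 + real l)\<^sup>2) \<le> (\<Sum>l=L..L+b. 1 / (1 + real l)\<^sup>2)"
    by (intro sum_mono2) auto
  also have "\<dots> \<le> 2 / (1 + real L)" using telescope[of b] by (smt (verit) divide_nonneg_nonneg of_nat_0_le_iff)
  finally show ?thesis .
qed

lemma sum_inverse_sqrt_le: "(\<Sum>l\<le>n. 1 / sqrt (1 + real l)) \<le> 2 * sqrt (1 + real n)"
proof (induction n)
  case 0
  show ?case by simp
next
  case (Suc n)
  define a b where "a = sqrt (1 + real n)" and "b = sqrt (2 + real n)"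
  have ab: "a\<^sup>2 = 1 + real n" "b\<^sup>2 = 2 + real n" "b > 0" "a \<ge> 0"
    by (auto simp: a_def b_def)
  \<comment> \<open>Since \<open>b\<^sup>2 = a\<^sup>2 + 1\<close>, this inequality says that the
    new summand \<open>1 / b\<close> is at most \<open>2 * (b - a)\<close>.\<close>
  have "2 * a * b \<le> a\<^sup>2 + b\<^sup>2" by (rule sum_squares_bound)
  then have "2 * a * b + 1 \<le> 2 * b * b" using ab by (simp add: power2_eq_square)
  then have "2 * a + 1 / b \<le> 2 * b" using ab by (simp add: field_simps)
  then show ?case using Suc by (simp add: a_def b_def add_ac)
qed

lemma finite_prefixes: "finite {u. prefix u t}"
  unfolding set_prefixes_eq[symmetric] by simp

text \<open>A path meets each level at most once, which turns sums along a path into sums over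
  levels.\<close>

lemma inj_on_length_prefixes: "inj_on length {u. prefix u t}"
  by (auto simp: inj_on_def) (metis prefix_length_prefix order_refl prefix_order.antisym)

lemma tree_weight_nonneg [simp]: "0 \<le> tree_weight t"
  by (simp add: tree_weight_def)

lemma sum_tree_weight_le:
  assumes "A \<subseteq> {u. prefix u x}" "\<And>t. t \<in> A \<Longrightarrow> L \<le> length t"
  shows "(\<Sum>t\<in>A. tree_weight t) \<le> 2 / (1 + real L)"
proof -
  have "inj_on length A" using assms(1) inj_on_length_prefixes inj_on_subset by blast
  then have "(\<Sum>t\<in>A. tree_weight t) = (\<Sum>l\<in>length ` A. 1 / (1 + real l)\<^sup>2)"
    by (simp add: sum.reindex tree_weight_def)
  also have "\<dots> \<le> 2 / (1 + real L)"
    using assms finite_subset[OF assms(1) finite_prefixes] by (intro sum_inverse_squares_le) auto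
  finally show ?thesis .
qed

text \<open>A bound on the square of \<open>l2_norm tree_weight f\<close>, stated by finite partial
  sums so that it includes membership in \<open>l2_space tree_weight\<close>.\<close>

definition energy_le :: "(node \<Rightarrow> real) \<Rightarrow> real \<Rightarrow> bool" where
  "energy_le f r \<longleftrightarrow> (\<forall>F. finite F \<longrightarrow> (\<Sum>t\<in>F. tree_weight t * (f t)\<^sup>2) \<le> r)"

lemma energy_leD: "energy_le f r \<Longrightarrow> finite F \<Longrightarrow> (\<Sum>t\<in>F. tree_weight t * (f t)\<^sup>2) \<le> r"
  by (simp add: energy_le_def)

lemma energy_le_nonneg: "energy_le f r \<Longrightarrow> 0 \<le> r"
  using energy_leD[of f r "{}"] by simp

lemma energy_le_zero: "energy_le (\<lambda>t. 0) 0"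
  by (simp add: energy_le_def)

lemma energy_le_imp:
  assumes "energy_le f r"
  shows "f \<in> l2_space tree_weight" and "l2_norm tree_weight f \<le> sqrt r"
proof -
  have s: "(\<lambda>t. tree_weight t * (f t)\<^sup>2) summable_on UNIV"
    by (rule nonneg_bdd_above_summable_on)
       (use assms in \<open>auto simp: energy_le_def bdd_above_def\<close>)
  then show "f \<in> l2_space tree_weight" by (simp add: l2_space_def)
  have "(\<Sum>\<^sub>\<infinity>t. tree_weight t * (f t)\<^sup>2) \<le> r"
    using s assms by (intro infsum_le_finite_sums) (auto simp: energy_le_def)
  then show "l2_norm tree_weight f \<le> sqrt r" by (simp add: l2_norm_def)
qed

lemma l2_norm_le_imp_energy_le:
  assumes "f \<in> l2_space tree_weight" "l2_norm tree_weight f \<le> r"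
  shows "energy_le f (r\<^sup>2)"
  unfolding energy_le_def
proof (intro allI impI)
  fix F :: "node set" assume F: "finite F"
  have s: "(\<lambda>t. tree_weight t * (f t)\<^sup>2) summable_on UNIV" using assms(1) by (simp add: l2_space_def)
  have "(\<Sum>t\<in>F. tree_weight t * (f t)\<^sup>2) \<le> (\<Sum>\<^sub>\<infinity>t. tree_weight t * (f t)\<^sup>2)"
    using s F by (intro finite_sum_le_infsum) auto
  also have "\<dots> \<le> r\<^sup>2" using assms(2) unfolding l2_norm_def by (simp add: sqrt_le_D)
  finally show "(\<Sum>t\<in>F. tree_weight t * (f t)\<^sup>2) \<le> r\<^sup>2" .
qed

lemma l2_space_imp_energy_le:
  assumes "f \<in> l2_space tree_weight"
  obtains r where "energy_le f r"
  using l2_norm_le_imp_energy_le[OF assms order_refl] by blast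

text \<open>A substitute for the triangle inequality on squared norms, from
  \<open>(a + b)\<^sup>2 \<le> 2 * a\<^sup>2 + 2 * b\<^sup>2\<close>; the loss of a factor only
  affects numerical constants.\<close>

lemma energy_le_add:
  assumes "energy_le f r" "energy_le g s"
  shows "energy_le (\<lambda>t. f t + g t) (2 * r + 2 * s)"
  unfolding energy_le_def
proof (intro allI impI)
  fix F :: "node set" assume F: "finite F"
  have "(\<Sum>t\<in>F. tree_weight t * (f t + g t)\<^sup>2)
      \<le> (\<Sum>t\<in>F. 2 * (tree_weight t * (f t)\<^sup>2) + 2 * (tree_weight t * (g t)\<^sup>2))"
  proof (rule sum_mono)
    fix t
    have "(f t + g t)\<^sup>2 \<le> 2 * (f t)\<^sup>2 + 2 * (g t)\<^sup>2"
      using sum_squares_bound[of "f t" "g t"] by (simp add: power2_sum)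
    from mult_left_mono[OF this tree_weight_nonneg[of t]]
    show "tree_weight t * (f t + g t)\<^sup>2 \<le> 2 * (tree_weight t * (f t)\<^sup>2) + 2 * (tree_weight t * (g t)\<^sup>2)"
      by (simp add: algebra_simps)
  qed
  also have "\<dots> \<le> 2 * r + 2 * s"
    using energy_leD[OF assms(1) F] energy_leD[OF assms(2) F]
    by (simp add: sum.distrib flip: sum_distrib_left)
  finally show "(\<Sum>t\<in>F. tree_weight t * (f t + g t)\<^sup>2) \<le> 2 * r + 2 * s" .
qed

lemma energy_le_scale:
  assumes "energy_le f r"
  shows "energy_le (\<lambda>t. c * f t) (c\<^sup>2 * r)"
  unfolding energy_le_def
proof (intro allI impI)
  fix F :: "node set" assume F: "finite F"
  have "(\<Sum>t\<in>F. tree_weight t * (c * f t)\<^sup>2) = c\<^sup>2 * (\<Sum>t\<in>F. tree_weight t * (f t)\<^sup>2)"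
    by (simp add: sum_distrib_left power_mult_distrib mult_ac)
  also have "\<dots> \<le> c\<^sup>2 * r" using energy_leD[OF assms F] by (intro mult_left_mono) auto
  finally show "(\<Sum>t\<in>F. tree_weight t * (c * f t)\<^sup>2) \<le> c\<^sup>2 * r" .
qed

lemma energy_le_diff:
  assumes "energy_le f r" "energy_le g s"
  shows "energy_le (\<lambda>t. f t - g t) (2 * r + 2 * s)"
  using energy_le_add[OF assms(1) energy_le_scale[OF assms(2), of "-1"]] by simp

lemma energy_le_mono: "energy_le f r \<Longrightarrow> r \<le> s \<Longrightarrow> energy_le f s"
  by (meson energy_le_def order_trans)

subsection \<open>Quantizing subtree masses\<close>

definition sub_prob :: "(node \<Rightarrow> real) \<Rightarrow> bool" where
  "sub_prob \<mu> \<longleftrightarrow> (\<forall>t. 0 \<le> \<mu> t) \<and> \<mu> summable_on UNIV \<and> (\<Sum>\<^sub>\<infinity>t. \<mu> t) \<le> 1"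

text \<open>Extension by zero lets the subtree sums at different nodes run over one common index
  set, so that they can be added termwise.\<close>

lemma has_sum_dual_summation_op:
  assumes "\<mu> summable_on UNIV"
  shows "((\<lambda>x. if prefix t x then \<mu> x else 0) has_sum dual_summation_op \<mu> t) UNIV"
proof -
  have "\<mu> summable_on {u. prefix t u}" using assms summable_on_subset_banach by blast
  then have "(\<mu> has_sum dual_summation_op \<mu> t) {u. prefix t u}"
    unfolding dual_summation_op_def by (rule has_sum_infsum)
  also have "?this \<longleftrightarrow> ?thesis" by (rule has_sum_cong_neutral) auto
  finally show ?thesis .
qed

text \<open>Exchanging the order of summation gives the integral over \<open>x\<close> with respect
  to \<mu> of the sums of \<open>g\<close> along the path to \<open>x\<close>. A bound on all path
  sums therefore survives, as the total mass is at most 1.\<close>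

lemma sum_mult_dual_summation_op_le:
  assumes \<mu>: "sub_prob \<mu>" and F: "finite F" and b: "0 \<le> b"
    and path: "\<And>x. (\<Sum>t | t \<in> F \<and> prefix t x. g t) \<le> b"
  shows "(\<Sum>t\<in>F. g t * dual_summation_op \<mu> t) \<le> b"
proof -
  have s: "\<mu> summable_on UNIV" and nn: "\<And>t. 0 \<le> \<mu> t" and le1: "(\<Sum>\<^sub>\<infinity>t. \<mu> t) \<le> 1"
    using \<mu> by (auto simp: sub_prob_def)
  have *: "((\<lambda>x. \<Sum>t\<in>G. g t * (if prefix t x then \<mu> x else 0)) has_sum
         (\<Sum>t\<in>G. g t * dual_summation_op \<mu> t)) UNIV" if "finite G" for G
    using that
    by induction (auto intro!: has_sum_add has_sum_cmult_right has_sum_dual_summation_op[OF s])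
  have "(\<Sum>t\<in>F. g t * dual_summation_op \<mu> t) \<le> b * (\<Sum>\<^sub>\<infinity>t. \<mu> t)"
  proof (rule has_sum_mono[OF *[OF F] has_sum_cmult_right[OF has_sum_infsum[OF s]]])
    fix x
    have "(\<Sum>t\<in>F. g t * (if prefix t x then \<mu> x else 0)) = (\<Sum>t | t \<in> F \<and> prefix t x. g t) * \<mu> x"
      unfolding sum_distrib_right using F by (intro sum.mono_neutral_cong_right) auto
    then show "(\<Sum>t\<in>F. g t * (if prefix t x then \<mu> x else 0)) \<le> b * \<mu> x"
      using mult_right_mono[OF path nn] by simp
  qed
  also have "\<dots> \<le> b" using mult_left_mono[OF le1 b] by simp
  finally show ?thesis .
qed

lemma dual_summation_op_sub_prob:
  assumes "sub_prob \<mu>"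
  shows dual_summation_op_nonneg: "0 \<le> dual_summation_op \<mu> t"
    and dual_summation_op_le_1: "dual_summation_op \<mu> t \<le> 1"
    and dual_summation_op_antimono: "prefix s t \<Longrightarrow> dual_summation_op \<mu> t \<le> dual_summation_op \<mu> s"
proof -
  have s: "\<mu> summable_on A" and nn: "\<And>t. 0 \<le> \<mu> t" and le1: "(\<Sum>\<^sub>\<infinity>t. \<mu> t) \<le> 1" for A
    using assms summable_on_subset_banach[of \<mu> UNIV A] by (auto simp: sub_prob_def)
  show "0 \<le> dual_summation_op \<mu> t" 
    unfolding dual_summation_op_def by (intro infsum_nonneg nn)
  have "dual_summation_op \<mu> t \<le> (\<Sum>\<^sub>\<infinity>t. \<mu> t)"
    unfolding dual_summation_op_def by (rule infsum_mono2[OF s s]) (use nn in auto)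
  with le1 show "dual_summation_op \<mu> t \<le> 1" by simp
  show "dual_summation_op \<mu> t \<le> dual_summation_op \<mu> s" if "prefix s t"
    unfolding dual_summation_op_def using that
    by (intro infsum_mono2[OF s s]) (use nn prefix_order.trans in auto)
qed

text \<open>The rounding step \<open>(1 + length t) / N\<close> is proportional to
  \<open>1 / sqrt (tree_weight t)\<close>, so rounding costs at most \<open>1 / N\<^sup>2\<close> of
  energy at every node.\<close>

definition quantize :: "nat \<Rightarrow> (node \<Rightarrow> real) \<Rightarrow> node \<Rightarrow> nat" where
  "quantize N m t = nat \<lfloor>real N * m t / (1 + real (length t))\<rfloor>"

lemma quantize_le:
  assumes "0 \<le> m t"
  shows "real (quantize N m t) \<le> real N * m t / (1 + real (length t))"
  using assms by (simp add: quantize_def)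

lemma quantize_pos_imp:
  assumes "quantize N m t \<noteq> 0"
  shows "1 + real (length t) \<le> real N * m t"
proof -
  have "1 \<le> real N * m t / (1 + real (length t))" using assms by (simp add: quantize_def)
  then show ?thesis by (simp add: le_divide_eq split: if_splits)
qed

lemma quantize_zero_imp:
  assumes "quantize N m t = 0"
  shows "real N * m t \<le> 1 + real (length t)"
proof -
  have "real N * m t / (1 + real (length t)) \<le> 1" using assms by (simp add: quantize_def)
  then show ?thesis by (simp add: divide_le_eq split: if_splits)
qed

lemma quantize_error:
  assumes "0 \<le> m t" "0 < N"
  shows "\<bar>m t - real (quantize N m t) * (1 + real (length t)) / real N\<bar> \<le> (1 + real (length t)) / real N"
proof -
  define y where "y = real N * m t / (1 + real (length t))"
  have y: "m t = y * (1 + real (length t)) / real N" "0 \<le> y"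
    using assms by (auto simp: y_def)
  have "\<bar>y - real (quantize N m t)\<bar> \<le> 1"
    using y(2) unfolding quantize_def y_def[symmetric] by linarith
  then have "\<bar>y - real (quantize N m t)\<bar> * ((1 + real (length t)) / real N) \<le> 1 * ((1 + real (length t)) / real N)"
    by (rule mult_right_mono) simp
  moreover have "m t - real (quantize N m t) * (1 + real (length t)) / real N
     = (y - real (quantize N m t)) * ((1 + real (length t)) / real N)"
    by (subst y(1)) (simp add: algebra_simps diff_divide_distrib)
  ultimately show ?thesis by (simp add: abs_mult)
qed

context
  fixes \<mu> :: "node \<Rightarrow> real" and N :: nat and m k
  assumes \<mu>: "sub_prob \<mu>" and N: "0 < N"
  defines "m \<equiv> dual_summation_op \<mu>"
  defines "k \<equiv> quantize N m"
begin

text \<open>The mass is at most 1, so a positive label forces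
  \<open>1 + length t \<le> N * m t \<le> N\<close>. Depth and labels are thus bounded by
  \<open>N\<close>, which leaves finitely many labellings.\<close>

lemma quantize_support:
  assumes "k t \<noteq> 0"
  shows "length t < N" "k t \<le> N"
proof -
  have m: "0 \<le> m t" "m t \<le> 1" using dual_summation_op_sub_prob[OF \<mu>] by (auto simp: m_def)
  have "real N * m t \<le> real N" using m N by (simp add: mult_left_le)
  moreover have "1 + real (length t) \<le> real N * m t"
    using quantize_pos_imp assms by (simp add: k_def)
  ultimately show "length t < N" by linarith
  have "real (k t) \<le> real N * m t / (1 + real (length t))"
    using quantize_le[of m t N] m by (simp add: k_def)
  also have "\<dots> \<le> real N * m t" using m by (simp add: divide_le_eq mult_le_cancel_left1 mult_less_0_iff)
  finally show "k t \<le> N" using \<open>real N * m t \<le> real N\<close> by linarith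
qed

lemma quantize_antimono:
  assumes "prefix s t" "k t \<noteq> 0"
  shows "k s \<noteq> 0"
proof
  assume s: "k s = 0"
  have "length s \<le> length t" using assms(1) by (rule prefix_length_le)
  moreover have "real N * m t \<le> real N * m s"
    using dual_summation_op_antimono[OF \<mu> assms(1)] by (simp add: m_def mult_left_mono)
  ultimately have 1: "1 + real (length s) \<le> real N * m s"
    using quantize_pos_imp assms(2) unfolding k_def by fastforce
  then have "1 \<le> real N * m s / (1 + real (length s))" by (simp add: le_divide_eq)
  then show False using s by (simp add: k_def quantize_def) 
qed

lemma finite_quantize_support: "finite {t. k t \<noteq> 0}"
proof (rule finite_subset)
  show "{t. k t \<noteq> 0} \<subseteq> {t. set t \<subseteq> UNIV \<and> length t \<le> N}" using quantize_support(1) less_imp_le by auto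
  show "finite {t::node. set t \<subseteq> UNIV \<and> length t \<le> N}" by (rule finite_lists_length_le) simp
qed

text \<open>
  Along a path the mass only decreases, so it is everywhere at least the threshold value at the
  last node of the path that carries a positive label.
\<close>

lemma sum_sqrt_quantize_le: "(\<Sum>t | k t \<noteq> 0. sqrt (real (k t))) \<le> 2 * real N"
proof -
  let ?S = "{t. k t \<noteq> 0}"
  have m0: "0 < m t" if "k t \<noteq> 0" for t
  proof -
    have "0 < real N * m t" using quantize_pos_imp[of N m t] that by (simp add: k_def)
    then show ?thesis using N by (simp add: zero_less_mult_iff)
  qed
  \<comment> \<open>The artificial factor \<open>m t\<close> turns the sum into an integral against
    \<mu>; it remains to bound the path sums of \<open>sqrt (k t) / m t\<close>.\<close>
  have "(\<Sum>t\<in>?S. sqrt (real (k t))) = (\<Sum>t\<in>?S. sqrt (real (k t)) / m t * m t)"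
    using m0 by (intro sum.cong) fastforce+
  also have "\<dots> \<le> 2 * real N"
    unfolding m_def
  proof (rule sum_mult_dual_summation_op_le[OF \<mu> finite_quantize_support], unfold m_def[symmetric])
    fix x
    define A where "A = {t. t \<in> ?S \<and> prefix t x}"
    have finA: "finite A" unfolding A_def using finite_quantize_support by auto
    show "(\<Sum>t | t \<in> ?S \<and> prefix t x. sqrt (real (k t)) / m t) \<le> 2 * real N"
    proof (cases "A = {}")
      case True
      then show ?thesis unfolding A_def[symmetric] by simp
    next
      case False
      define L where "L = Max (length ` A)"
      have "L \<in> length ` A" unfolding L_def using False finA by (intro Max_in) auto
      then obtain z where z: "z \<in> A" "length z = L" by auto
      have le: "length t \<le> L" if "t \<in> A" for t using that finA by (simp add: L_def)
      have pointwise: "sqrt (real (k t)) / m t \<le> real N / sqrt (1 + real L) * (1 / sqrt (1 + real (length t)))"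
        if "t \<in> A" for t
      proof -
        have "prefix t z" using that z le[OF that] unfolding A_def by (auto intro: prefix_length_prefix)
        then have "m z \<le> m t" unfolding m_def by (rule dual_summation_op_antimono[OF \<mu>])
        moreover have "1 + real L \<le> real N * m z"
          using quantize_pos_imp[of N m z] z by (auto simp: k_def A_def)
        ultimately have big: "1 + real L \<le> real N * m t"
          using N by (meson mult_left_mono of_nat_0_le_iff order_trans)
        have mt: "0 < m t" using m0 that by (auto simp: A_def)
        \<comment> \<open>Multiplying this by \<open>sqrt (1 + L) \<le> sqrt (N * m t)\<close>
          produces a full factor \<open>m t\<close>, which cancels the denominator
          \<open>m t\<close>.\<close>
        have "sqrt (real (k t)) \<le> sqrt (real N * m t / (1 + real (length t)))"
          unfolding k_def using mt by (intro real_sqrt_le_mono quantize_le) simp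
        then have "sqrt (real (k t)) * sqrt (1 + real L)
            \<le> sqrt (real N * m t / (1 + real (length t))) * sqrt (real N * m t)"
          using big by (intro mult_mono real_sqrt_le_mono) (auto simp: mt less_imp_le)
        also have "\<dots> = real N * m t / sqrt (1 + real (length t))"
          using mt by (simp add: real_sqrt_divide)
        finally show ?thesis using mt by (simp add: field_simps)
      qed
      have "(\<Sum>t\<in>A. 1 / sqrt (1 + real (length t))) = (\<Sum>l\<in>length ` A. 1 / sqrt (1 + real l))"
        using inj_on_subset[OF inj_on_length_prefixes[of x], of A] by (simp add: sum.reindex A_def subset_eq)
      also have "\<dots> \<le> (\<Sum>l\<le>L. 1 / sqrt (1 + real l))"
        using le by (intro sum_mono2) auto
      also have "\<dots> \<le> 2 * sqrt (1 + real L)" by (rule sum_inverse_sqrt_le)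
      finally have path: "(\<Sum>t\<in>A. 1 / sqrt (1 + real (length t))) \<le> 2 * sqrt (1 + real L)" .
      have "(\<Sum>t\<in>A. sqrt (real (k t)) / m t)
          \<le> real N / sqrt (1 + real L) * (\<Sum>t\<in>A. 1 / sqrt (1 + real (length t)))"
        unfolding sum_distrib_left by (rule sum_mono) (rule pointwise)
      also have "\<dots> \<le> real N / sqrt (1 + real L) * (2 * sqrt (1 + real L))"
        using path by (rule mult_left_mono) simp
      also have "\<dots> = 2 * real N" by (simp add: add_nonneg_eq_0_iff)
      finally show ?thesis unfolding A_def[symmetric] .
    qed
  qed simp
  finally show ?thesis .
qed

text \<open>Nodes with a positive label and nodes with label 0 contribute at most
  \<open>2 / N\<close> each: the former by the bound on the sum of \<open>sqrt (k t)\<close>, the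
  latter by integrating \<open>tree_weight t * m t\<close> along paths.\<close>

lemma energy_le_quantize_error:
  "energy_le (\<lambda>t. m t - real (k t) * (1 + real (length t)) / real N) (4 / real N)"
  unfolding energy_le_def
proof (intro allI impI)
  fix F :: "node set" assume F: "finite F"
  let ?S = "{t. k t \<noteq> 0}"
  let ?e = "\<lambda>t. m t - real (k t) * (1 + real (length t)) / real N"
  have m0: "0 \<le> m t" for t unfolding m_def by (rule dual_summation_op_nonneg[OF \<mu>])
  have "(\<Sum>t\<in>F \<inter> ?S. tree_weight t * (?e t)\<^sup>2) \<le> (\<Sum>t\<in>F \<inter> ?S. sqrt (real (k t)) * (1 / (real N)\<^sup>2))"
  proof (rule sum_mono)
    fix t assume t: "t \<in> F \<inter> ?S"
    have "(?e t)\<^sup>2 \<le> ((1 + real (length t)) / real N)\<^sup>2"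
      using quantize_error[where m = m and t = t, OF m0 N]
      unfolding abs_le_square_iff[symmetric] k_def by simp
    then have "tree_weight t * (?e t)\<^sup>2 \<le> tree_weight t * ((1 + real (length t)) / real N)\<^sup>2"
      by (intro mult_left_mono) auto
    also have "\<dots> = 1 * (1 / (real N)\<^sup>2)"
      by (simp add: tree_weight_def power_divide add_nonneg_eq_0_iff)
    \<comment> \<open>A positive label has \<open>1 \<le> sqrt (k t)\<close>, so the label sum also
      bounds the number of labelled nodes.\<close>
    also have "\<dots> \<le> sqrt (real (k t)) * (1 / (real N)\<^sup>2)"
      using t by (intro mult_right_mono) auto
    finally show "tree_weight t * (?e t)\<^sup>2 \<le> sqrt (real (k t)) * (1 / (real N)\<^sup>2)" .
  qed
  also have "\<dots> \<le> (\<Sum>t\<in>?S. sqrt (real (k t))) * (1 / (real N)\<^sup>2)"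
    unfolding sum_distrib_right using finite_quantize_support by (intro sum_mono2) auto
  also have "\<dots> \<le> 2 * real N * (1 / (real N)\<^sup>2)"
    by (intro mult_right_mono sum_sqrt_quantize_le) simp
  also have "\<dots> = 2 / real N" by (simp add: power2_eq_square)
  finally have inner: "(\<Sum>t\<in>F \<inter> ?S. tree_weight t * (?e t)\<^sup>2) \<le> 2 / real N" .

  \<comment> \<open>With label 0 the error is \<open>m t\<close> itself; one of its two factors
    serves as the mass to integrate against.\<close>
  have "(\<Sum>t\<in>F - ?S. tree_weight t * (?e t)\<^sup>2) = (\<Sum>t\<in>F - ?S. tree_weight t * m t * m t)"
    by (intro sum.cong) (auto simp: power2_eq_square)
  also have "\<dots> \<le> 2 / real N"
    unfolding m_def
  proof (rule sum_mult_dual_summation_op_le[OF \<mu>], unfold m_def[symmetric])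
    fix x
    define A where "A = {t. t \<in> F - ?S \<and> prefix t x}"
    have finA: "finite A" unfolding A_def using F by auto
    show "(\<Sum>t | t \<in> F - ?S \<and> prefix t x. tree_weight t * m t) \<le> 2 / real N"
    proof (cases "A = {}")
      case True
      then show ?thesis unfolding A_def[symmetric] by simp
    next
      case False
      \<comment> \<open>At the first node \<open>z\<close> of the path in \<open>A\<close> the mass
        is below the threshold \<open>(1 + L) / N\<close>, and it only decreases from there. The
        factor \<open>1 + L\<close> cancels against the weight \<open>2 / (1 + L)\<close> of the
        rest of the path.\<close>
      define L where "L = Min (length ` A)"
      have "L \<in> length ` A" unfolding L_def using False finA by (intro Min_in) auto
      then obtain z where z: "z \<in> A" "length z = L" by auto
      have le: "L \<le> length t" if "t \<in> A" for t using that finA by (simp add: L_def)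
      have mz: "m z \<le> (1 + real L) / real N"
        using quantize_zero_imp[of N m z] z N by (auto simp: A_def k_def field_simps)
      have "m t \<le> (1 + real L) / real N" if "t \<in> A" for t
      proof -
        have "prefix z t" using that z le[OF that] unfolding A_def by (auto intro: prefix_length_prefix)
        then have "m t \<le> m z" unfolding m_def by (rule dual_summation_op_antimono[OF \<mu>])
        then show ?thesis using mz by simp
      qed
      then have "(\<Sum>t\<in>A. tree_weight t * m t) \<le> (\<Sum>t\<in>A. tree_weight t) * ((1 + real L) / real N)"
        unfolding sum_distrib_right
        by (intro sum_mono mult_left_mono) auto
      also have "\<dots> \<le> 2 / (1 + real L) * ((1 + real L) / real N)"
        by (intro mult_right_mono sum_tree_weight_le[of _ x]) (auto simp: le, auto simp: A_def)
      also have "\<dots> = 2 / real N" using N by (simp add: field_simps add_nonneg_eq_0_iff)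
      finally show ?thesis unfolding A_def[symmetric] .
    qed
  qed (use F in auto)
  finally have "(\<Sum>t\<in>F - ?S. tree_weight t * (?e t)\<^sup>2) \<le> 2 / real N" .
  moreover have "(\<Sum>t\<in>F. tree_weight t * (?e t)\<^sup>2)
      = (\<Sum>t\<in>F \<inter> ?S. tree_weight t * (?e t)\<^sup>2) + (\<Sum>t\<in>F - ?S. tree_weight t * (?e t)\<^sup>2)"
    using F by (rule sum.Int_Diff)
  ultimately show "(\<Sum>t\<in>F. tree_weight t * (?e t)\<^sup>2) \<le> 4 / real N"
    using inner by (simp add: add_divide_distrib[symmetric])
qed

end

text \<open>One factor of the square is bounded by 1, the other is integrated; the 2 is the bound on
  the total weight of a path.\<close>

lemma energy_le_dual_summation_op:
  assumes \<mu>: "sub_prob \<mu>"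
  shows "energy_le (dual_summation_op \<mu>) 2"
  unfolding energy_le_def power2_eq_square mult.assoc[symmetric]
proof (intro allI impI, rule sum_mult_dual_summation_op_le[OF \<mu>])
  fix F :: "node set" and x assume F: "finite F"
  have "(\<Sum>t | t \<in> F \<and> prefix t x. tree_weight t * dual_summation_op \<mu> t)
      \<le> (\<Sum>t | t \<in> F \<and> prefix t x. tree_weight t)"
    by (intro sum_mono mult_left_le) (auto simp: dual_summation_op_le_1[OF \<mu>])
  also have "\<dots> \<le> 2" using sum_tree_weight_le[of "{t. t \<in> F \<and> prefix t x}" x 0] by auto
  finally show "(\<Sum>t | t \<in> F \<and> prefix t x. tree_weight t * dual_summation_op \<mu> t) \<le> 2" .
qed auto

subsection \<open>Counting labelled subtrees\<close>

fun glue :: "nat \<Rightarrow> (node \<Rightarrow> nat) \<Rightarrow> (node \<Rightarrow> nat) \<Rightarrow> node \<Rightarrow> nat" where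
  "glue j a b [] = j"
| "glue j a b (x # t) = (if x then b t else a t)"

text \<open>The recursion splits off the root, so subtrees are addressed by removing the head of a node.\<close>

primrec labellings :: "nat \<Rightarrow> nat \<Rightarrow> (node \<Rightarrow> nat) set" where
  "labellings M 0 = {\<lambda>t. 0}"
| "labellings M (Suc d) = insert (\<lambda>t. 0)
     ((\<lambda>(j, a, b). glue j a b) ` ({1..M} \<times> labellings M d \<times> labellings M d))"

lemma finite_labellings: "finite (labellings M d)"
  by (induction d) auto

text \<open>As the support is closed under prefixes, a labelling that vanishes at the root vanishes
  everywhere, which is the inserted zero labelling; any other one is glued from its root label and
  its two restrictions.\<close>

lemma in_labellings:
  assumes "\<And>t. length t \<ge> d \<Longrightarrow> k t = 0" "\<And>t. k t \<le> M"
    and "\<And>s t. prefix s t \<Longrightarrow> k t \<noteq> 0 \<Longrightarrow> k s \<noteq> 0"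
  shows "k \<in> labellings M d"
  using assms
proof (induction d arbitrary: k)
  case 0
  then show ?case by (auto simp: fun_eq_iff)
next
  case (Suc d)
  have sub: "(\<lambda>t. k (x # t)) \<in> labellings M d" for x
  proof (rule Suc.IH)
    show "k (x # s) \<noteq> 0" if "prefix s t" "k (x # t) \<noteq> 0" for s t
      using Suc.prems(3)[of "x # s" "x # t"] that by simp
  qed (use Suc.prems in auto)
  show ?case
  proof (cases "k [] = 0")
    case True
    then have "k = (\<lambda>t. 0)" using Suc.prems(3)[of "[]"] by auto
    then show ?thesis by simp
  next
    case False
    have "k = (\<lambda>(j, a, b). glue j a b) (k [], \<lambda>t. k (False # t), \<lambda>t. k (True # t))"
    proof
      show "k t = (\<lambda>(j, a, b). glue j a b) (k [], \<lambda>t. k (False # t), \<lambda>t. k (True # t)) t" for t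
        by (cases t) auto
    qed
    moreover have "(k [], \<lambda>t. k (False # t), \<lambda>t. k (True # t)) \<in> {1..M} \<times> labellings M d \<times> labellings M d"
      using sub Suc.prems(2) False by auto
    ultimately show ?thesis unfolding labellings.simps by (intro insertI2 image_eqI)
  qed
qed

text \<open>Weights for the generating function, not a probability distribution: label 0 has weight
  1, so that unlabelled nodes do not change products, and the positive labels have a telescoping sum
  of at most \<open>1 / 4\<close>.\<close>

definition label_prob :: "nat \<Rightarrow> real" where
  "label_prob j = (if j = 0 then 1 else 1 / (4 * (real j * (real j + 1))))"

lemma label_prob_nonneg: "0 \<le> label_prob j"
  by (simp add: label_prob_def)

lemma sum_label_prob_le: "(\<Sum>j=1..M. label_prob j) \<le> 1 / 4"
proof -
  have "(\<Sum>j=1..M. label_prob j) = 1 / 4 - 1 / (4 * (real M + 1))"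
  proof (induction M)
    case (Suc M)
    have "(\<Sum>j=1..Suc M. label_prob j) = 1 / 4 - 1 / (4 * (real M + 1)) + label_prob (Suc M)"
      using Suc by simp
    also have "\<dots> = 1 / 4 - 1 / (4 * (real (Suc M) + 1))"
      by (simp add: label_prob_def divide_simps) (simp add: algebra_simps)
    finally show ?case .
  qed simp
  then show ?thesis by simp
qed

text \<open>With \<open>y = sqrt j \<ge> 1\<close>, the Taylor bound gives
  \<open>3 + 2 * j \<le> exp (2 * y)\<close>, and squaring yields
  \<open>4 * j * (j + 1) \<le> exp (4 * y)\<close>. This converts bounds on sums of
  \<open>sqrt (k t)\<close> into lower bounds on weights.\<close>

lemma exp_le_label_prob: "exp (- (4 * sqrt (real j))) \<le> label_prob j"
proof (cases "j = 0")
  case False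
  define y where "y = sqrt (real j)"
  have y: "0 \<le> y" "real j = y\<^sup>2" "1 \<le> real j" using False by (auto simp: y_def)
  have "1 \<le> y" using False by (simp add: y_def)
  moreover have "1 + 2 * y + 2 * y\<^sup>2 \<le> exp (2 * y)"
    using exp_lower_Taylor_quadratic[of "2 * y"] y(1) by (simp add: power2_eq_square)
  ultimately have "3 + 2 * y\<^sup>2 \<le> exp (2 * y)" by linarith
  then have "(3 + 2 * y\<^sup>2) * (3 + 2 * y\<^sup>2) \<le> exp (2 * y) * exp (2 * y)"
    by (intro mult_mono) auto
  also have "\<dots> = exp (4 * y)" by (simp add: exp_add[symmetric])
  finally have "(3 + 2 * real j) * (3 + 2 * real j) \<le> exp (4 * y)" by (simp add: y(2))
  then have "4 * (real j * (real j + 1)) \<le> exp (4 * y)" by (simp add: algebra_simps)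
  then have "1 / exp (4 * y) \<le> 1 / (4 * (real j * (real j + 1)))"
    using False by (intro divide_left_mono) auto
  then show ?thesis using False by (simp add: label_prob_def exp_minus y_def inverse_eq_divide)
qed (simp add: label_prob_def)

lemma finite_nodes: "finite {t :: node. length t < d}"
  by (rule finite_subset[OF _ finite_lists_length_le[of UNIV d]]) auto

lemma nodes_Suc:
  "{t :: node. length t < Suc d}
   = insert [] ((#) False ` {t. length t < d} \<union> (#) True ` {t. length t < d})"
proof -
  have "t = [] \<or> t \<in> (#) False ` {t. length t < d} \<or> t \<in> (#) True ` {t. length t < d}"
    if "length t < Suc d" for t :: node
    using that by (cases t) (auto simp: image_iff)
  then show ?thesis by auto
qed

definition labelling_weight :: "nat \<Rightarrow> (node \<Rightarrow> nat) \<Rightarrow> real" where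
  "labelling_weight d k = (\<Prod>t | length t < d. label_prob (k t))"

lemma labelling_weight_nonneg: "0 \<le> labelling_weight d k"
  unfolding labelling_weight_def by (intro prod_nonneg) (simp add: label_prob_nonneg)

lemma labelling_weight_glue:
  "labelling_weight (Suc d) (glue j a b)
   = label_prob j * (labelling_weight d a * labelling_weight d b)"
proof -
  have "labelling_weight (Suc d) (glue j a b) =
      label_prob j * (\<Prod>t \<in> (#) False ` {t. length t < d} \<union> (#) True ` {t. length t < d}.
        label_prob (glue j a b t))"
    unfolding labelling_weight_def nodes_Suc using finite_nodes by (subst prod.insert) auto
  also have "(\<Prod>t \<in> (#) False ` {t. length t < d} \<union> (#) True ` {t. length t < d}.
        label_prob (glue j a b t))
      = (\<Prod>t \<in> (#) False ` {t. length t < d}. label_prob (glue j a b t))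
        * (\<Prod>t \<in> (#) True ` {t. length t < d}. label_prob (glue j a b t))"
    using finite_nodes by (intro prod.union_disjoint) auto
  also have "\<dots> = labelling_weight d a * labelling_weight d b"
    unfolding labelling_weight_def by (simp add: prod.reindex)
  finally show ?thesis .
qed

text \<open>
  Generating function of the labelled subtrees: with \<open>Z\<close> the total weight of depth \<open>d\<close>, that of
  depth \<open>d + 1\<close> is at most \<open>1 + Z\<^sup>2 / 4\<close>, and \<open>2\<close> is the fixed point of this map.
\<close>

lemma sum_labelling_weight_le: "(\<Sum>k\<in>labellings M d. labelling_weight d k) \<le> 2"
proof (induction d)
  case 0
  show ?case by (simp add: labelling_weight_def)
next
  case (Suc d)
  let ?Z = "\<Sum>k\<in>labellings M d. labelling_weight d k"
  let ?D = "{1..M} \<times> labellings M d \<times> labellings M d"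
  let ?w = "labelling_weight (Suc d)"
  have ZZ: "?Z * ?Z = (\<Sum>a\<in>labellings M d. \<Sum>b\<in>labellings M d. labelling_weight d a * labelling_weight d b)"
    by (rule sum_product)
  have Z: "0 \<le> ?Z" by (intro sum_nonneg labelling_weight_nonneg)
  have "(\<Sum>k\<in>labellings M (Suc d). ?w k) \<le> ?w (\<lambda>t. 0) + (\<Sum>k\<in>(\<lambda>(j, a, b). glue j a b) ` ?D. ?w k)"
    unfolding labellings.simps
    by (subst sum.insert_if) (auto simp: finite_labellings labelling_weight_nonneg)
  also have "?w (\<lambda>t. 0) = 1" by (simp add: labelling_weight_def label_prob_def)
  also have "(\<Sum>k\<in>(\<lambda>(j, a, b). glue j a b) ` ?D. ?w k) \<le> (\<Sum>p\<in>?D. ?w (case p of (j, a, b) \<Rightarrow> glue j a b))"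
    using sum_image_le[of ?D ?w "\<lambda>(j, a, b). glue j a b"]
    by (simp add: finite_labellings labelling_weight_nonneg o_def)
  also have "\<dots> = (\<Sum>p\<in>?D. case p of (j, a, b) \<Rightarrow>
      label_prob j * (labelling_weight d a * labelling_weight d b))"
    by (intro sum.cong) (auto simp: labelling_weight_glue)
  also have "\<dots> = (\<Sum>j=1..M. label_prob j) * (?Z * ?Z)"
    unfolding ZZ by (subst sum_distrib_right) (simp add: sum_distrib_left sum.cartesian_product[symmetric])
  also have "\<dots> \<le> 1 / 4 * (2 * 2)"
    using Suc Z by (intro mult_mono sum_label_prob_le) (auto intro: sum_nonneg label_prob_nonneg)
  finally show ?case by simp
qed

definition cheap_labellings :: "nat \<Rightarrow> (node \<Rightarrow> nat) set" where
  "cheap_labellings N =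
     {k \<in> labellings N N. (\<Sum>t | k t \<noteq> 0. sqrt (real (k t))) \<le> 2 * real N}"

lemma finite_cheap_labellings: "finite (cheap_labellings N)"
  using finite_labellings by (simp add: cheap_labellings_def)

lemma labellings_zero: "k \<in> labellings M d \<Longrightarrow> d \<le> length t \<Longrightarrow> k t = 0"
proof (induction d arbitrary: k t)
  case (Suc d)
  then show ?case by (cases t) auto
qed simp

text \<open>Every cheap labelling has weight at least \<open>exp (- 4 * (2 * N))\<close>, while the
  total weight of all labellings is at most 2.\<close>

lemma card_cheap_labellings_le: "real (card (cheap_labellings N)) \<le> 2 * exp (8 * real N)"
proof -
  have weight: "exp (- (8 * real N)) \<le> labelling_weight N k" if "k \<in> cheap_labellings N" for k
  proof -
    have "(\<Sum>t | length t < N. sqrt (real (k t))) = (\<Sum>t | k t \<noteq> 0. sqrt (real (k t)))"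
    proof (intro sum.mono_neutral_right finite_nodes)
      show "{t. k t \<noteq> 0} \<subseteq> {t. length t < N}"
        using labellings_zero[of k N N] that by (force simp: cheap_labellings_def not_less[symmetric])
    qed auto
    then have "exp (- (8 * real N)) \<le> exp (\<Sum>t | length t < N. - (4 * sqrt (real (k t))))"
      using that by (simp add: cheap_labellings_def sum_negf flip: sum_distrib_left)
    also have "\<dots> = (\<Prod>t | length t < N. exp (- (4 * sqrt (real (k t)))))"
      by (rule exp_sum) (rule finite_nodes)
    also have "\<dots> \<le> labelling_weight N k"
      unfolding labelling_weight_def by (intro prod_mono conjI exp_le_label_prob) simp
    finally show ?thesis .
  qed
  have "real (card (cheap_labellings N)) * exp (- (8 * real N))
      = (\<Sum>k\<in>cheap_labellings N. exp (- (8 * real N)))" by simp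
  also have "\<dots> \<le> (\<Sum>k\<in>cheap_labellings N. labelling_weight N k)"
    by (rule sum_mono) (rule weight)
  also have "\<dots> \<le> (\<Sum>k\<in>labellings N N. labelling_weight N k)"
    by (intro sum_mono2 finite_labellings labelling_weight_nonneg) (auto simp: cheap_labellings_def)
  also have "\<dots> \<le> 2" by (rule sum_labelling_weight_le)
  finally show ?thesis by (simp add: exp_minus field_simps)
qed

lemma quantize_in_cheap_labellings:
  assumes "sub_prob \<mu>" "0 < N"
  shows "quantize N (dual_summation_op \<mu>) \<in> cheap_labellings N"
proof -
  have "quantize N (dual_summation_op \<mu>) \<in> labellings N N"
    using quantize_support[OF assms] quantize_antimono[OF assms]
    by (intro in_labellings) (metis linorder_not_le, metis zero_le, blast)
  then show ?thesis
    using sum_sqrt_quantize_le[OF assms] by (simp add: cheap_labellings_def)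
qed

section \<open>Covering the image of the unit ball under the dual operator\<close>

definition dual_ball :: "real \<Rightarrow> (node \<Rightarrow> real) set" where
  "dual_ball r = {dual_summation_op \<mu> |\<mu>. \<mu> \<in> l1_space \<and> l1_norm \<mu> \<le> r}"

text \<open>The positive and negative parts are dominated by the absolute value, hence each has mass
  at most 1. This reduces signed functions to nonnegative ones.\<close>

lemma dual_ball_1_decompose:
  assumes "h \<in> dual_ball 1"
  obtains \<mu> \<nu> where "sub_prob \<mu>" "sub_prob \<nu>"
    "h = (\<lambda>t. dual_summation_op \<mu> t - dual_summation_op \<nu> t)"
proof -
  obtain \<mu> where \<mu>: "(\<lambda>t. \<bar>\<mu> t\<bar>) summable_on UNIV" "(\<Sum>\<^sub>\<infinity>t. \<bar>\<mu> t\<bar>) \<le> 1" and h: "h = dual_summation_op \<mu>"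
    using assms by (auto simp: dual_ball_def l1_space_def l1_norm_def)
  have sub: "sub_prob g" if g: "\<And>t. 0 \<le> g t" "\<And>t. g t \<le> \<bar>\<mu> t\<bar>" for g
  proof -
    have "g summable_on UNIV" using summable_on_comparison_test[OF \<mu>(1)] g by auto
    moreover from this have "(\<Sum>\<^sub>\<infinity>t. g t) \<le> (\<Sum>\<^sub>\<infinity>t. \<bar>\<mu> t\<bar>)"
      using \<mu>(1) g by (intro infsum_mono) auto
    ultimately show ?thesis using g \<mu>(2) by (auto simp: sub_prob_def)
  qed
  define p q where "p = (\<lambda>t. max (\<mu> t) 0)" and "q = (\<lambda>t. max (- \<mu> t) 0)"
  have pq: "sub_prob p" "sub_prob q" by (rule sub; auto simp: p_def q_def)+
  have "h t = dual_summation_op p t - dual_summation_op q t" for t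
  proof -
    have s: "p summable_on {u. prefix t u}" "q summable_on {u. prefix t u}"
      using pq summable_on_subset_banach by (auto simp: sub_prob_def)
    have "dual_summation_op \<mu> t = (\<Sum>\<^sub>\<infinity>u | prefix t u. p u + - q u)"
      unfolding dual_summation_op_def by (intro infsum_cong) (simp add: p_def q_def max_def)
    also have "\<dots> = dual_summation_op p t + (\<Sum>\<^sub>\<infinity>u | prefix t u. - q u)"
      unfolding dual_summation_op_def using s by (intro infsum_add) (simp_all add: summable_on_uminus)
    finally show ?thesis by (simp add: h dual_summation_op_def infsum_uminus)
  qed
  with pq that show ?thesis by blast
qed

lemma energy_le_dual_ball:
  assumes "h \<in> dual_ball 1"
  shows "energy_le h 8"
proof -
  obtain \<mu> \<nu> where mn: "sub_prob \<mu>" "sub_prob \<nu>"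
    "h = (\<lambda>t. dual_summation_op \<mu> t - dual_summation_op \<nu> t)"
    by (rule dual_ball_1_decompose[OF assms])
  show ?thesis
    using energy_le_diff[OF mn(1,2)[THEN energy_le_dual_summation_op]] by (simp add: mn(3))
qed

lemma dual_ball_covering:
  fixes \<rho> :: real
  assumes "0 < \<rho>"
  shows "\<exists>S. finite S \<and> S \<subseteq> l2_space tree_weight \<and> real (card S) \<le> exp (600 / \<rho>\<^sup>2)
    \<and> (\<forall>h\<in>dual_ball 1. \<exists>c\<in>S. energy_le (\<lambda>t. c t - h t) (\<rho>\<^sup>2))"
proof (cases "\<rho> \<le> 3")
  case False
  then have "8 \<le> \<rho>\<^sup>2" using power_mono[of 3 \<rho> 2] by simp
  then have "energy_le (\<lambda>t. 0 - h t) (\<rho>\<^sup>2)" if "h \<in> dual_ball 1" for h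
    using energy_le_mono[OF energy_le_scale[OF energy_le_dual_ball[OF that], of "-1"], of "\<rho>\<^sup>2"] by simp
  then show ?thesis
    using energy_le_imp(1)[OF energy_le_zero] by (intro exI[of _ "{\<lambda>t. 0}"]) auto
next
  case True
  \<comment> \<open>Quantizing both parts gives the error
    \<open>2 * (4 / N) + 2 * (4 / N) = 16 / N\<close>, which has to be at most
    \<open>\<rho>\<^sup>2\<close>.\<close>
  define N where "N = nat \<lceil>16 / \<rho>\<^sup>2\<rceil>"
  have \<rho>2: "0 < \<rho>\<^sup>2" "\<rho>\<^sup>2 \<le> 9" using assms True power_mono[of \<rho> 3 2] by auto
  have N: "16 / \<rho>\<^sup>2 \<le> real N" "real N \<le> 16 / \<rho>\<^sup>2 + 1" "0 < N"
    using \<rho>2 by (auto simp: N_def)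
  have "1 \<le> 9 / \<rho>\<^sup>2" using \<rho>2 by simp
  \<comment> \<open>Here \<open>N \<le> 25 / \<rho>\<^sup>2\<close>. The 18 allows for two factors
    \<open>exp (8 * N)\<close> and the prefactor
    \<open>2 * 2 \<le> exp 2 \<le> exp (2 * N)\<close>.\<close>
  with N have N': "18 * real N \<le> 600 / \<rho>\<^sup>2" by (simp add: field_simps)
  define f where "f = (\<lambda>(a, b) (t::node).
    real (a t :: nat) * (1 + real (length t)) / real N - real (b t :: nat) * (1 + real (length t)) / real N)"
  \<comment> \<open>The intersection keeps the centres in the space; those that are used lie in it,
    being at finite energy distance from some \<open>h\<close> of finite energy.\<close>
  let ?S = "f ` (cheap_labellings N \<times> cheap_labellings N) \<inter> l2_space tree_weight"
  have cover: "\<exists>c\<in>?S. energy_le (\<lambda>t. c t - h t) (\<rho>\<^sup>2)" if h: "h \<in> dual_ball 1" for h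
  proof -
    obtain \<mu> \<nu> where mn: "sub_prob \<mu>" "sub_prob \<nu>"
      "h = (\<lambda>t. dual_summation_op \<mu> t - dual_summation_op \<nu> t)"
      by (rule dual_ball_1_decompose[OF h])
    define a b where "a = quantize N (dual_summation_op \<mu>)" and "b = quantize N (dual_summation_op \<nu>)"
    let ?c = "f (a, b)"
    have "energy_le (\<lambda>t. ?c t - h t) (2 * (4 / real N) + 2 * (4 / real N))"
      using energy_le_diff[OF energy_le_quantize_error[OF mn(2) N(3)] energy_le_quantize_error[OF mn(1) N(3)]]
      by (simp add: f_def a_def b_def mn(3) algebra_simps)
    moreover have "2 * (4 / real N) + 2 * (4 / real N) \<le> \<rho>\<^sup>2" using N(1,3) \<rho>2 by (simp add: field_simps)
    ultimately have e: "energy_le (\<lambda>t. ?c t - h t) (\<rho>\<^sup>2)" by (rule energy_le_mono)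
    have "?c \<in> l2_space tree_weight"
      using energy_le_imp(1)[OF energy_le_add[OF e energy_le_dual_ball[OF h]]] by simp
    moreover have "a \<in> cheap_labellings N" "b \<in> cheap_labellings N"
      unfolding a_def b_def using mn N(3) by (auto intro: quantize_in_cheap_labellings)
    ultimately show ?thesis using e by blast
  qed
  have "real (card ?S) \<le> real (card (cheap_labellings N \<times> cheap_labellings N))"
    by (intro of_nat_mono order.trans[OF card_mono card_image_le] finite_imageI)
       (auto simp: finite_cheap_labellings)
  also have "\<dots> \<le> (2 * exp (8 * real N)) * (2 * exp (8 * real N))"
    unfolding card_cartesian_product of_nat_mult
    by (intro mult_mono card_cheap_labellings_le) auto
  also have "\<dots> = 2 * 2 * exp (16 * real N)" by (simp add: exp_add[symmetric])
  also have "\<dots> \<le> exp 1 * exp 1 * exp (16 * real N)"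
    using exp_ge_add_one_self[of 1] by (intro mult_mono) auto
  also have "\<dots> = exp (16 * real N + 2)" by (simp add: exp_add[symmetric])
  also have "\<dots> \<le> exp (600 / \<rho>\<^sup>2)" using N' N(3) by simp
  finally have "real (card ?S) \<le> exp (600 / \<rho>\<^sup>2)" .
  then show ?thesis
    using cover finite_cheap_labellings[of N] by (intro exI[of _ ?S]) auto
qed

subsection \<open>Duality\<close>

abbreviation tree_sum :: "(node \<Rightarrow> real) \<Rightarrow> node \<Rightarrow> real" where
  "tree_sum \<equiv> summation_op tree_weight"

lemma tree_sum_diff: "tree_sum (\<lambda>t. f t - g t) x = tree_sum f x - tree_sum g x"
  by (simp add: summation_op_def right_diff_distrib sum_subtractf)

lemma tree_sum_scale: "tree_sum (\<lambda>t. c * f t) x = c * tree_sum f x"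
  by (simp add: summation_op_def sum_distrib_left mult_ac)

text \<open>In the weighted inner product the indicator of the path to \<open>x\<close> represents
  the functional \<open>tree_sum r x\<close>, and its squared norm is the weight of the path, at
  most 2. The claim is the expanded square.\<close>

lemma energy_le_diff_path:
  assumes "energy_le r e"
  shows "energy_le (\<lambda>u. r u - s * of_bool (prefix u x)) (e - 2 * s * tree_sum r x + 2 * s\<^sup>2)"
  unfolding energy_le_def
proof (intro allI impI)
  fix F :: "node set" assume F: "finite F"
  define P where "P = {u. prefix u x}"
  have finP: "finite P" unfolding P_def by (rule finite_prefixes)
  \<comment> \<open>Adding the whole path to \<open>F\<close> makes the cross term exactly
    \<open>tree_sum r x\<close>.\<close>
  have "(\<Sum>u\<in>F. tree_weight u * (r u - s * of_bool (prefix u x))\<^sup>2)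
      \<le> (\<Sum>u\<in>F \<union> P. tree_weight u * (r u - s * of_bool (prefix u x))\<^sup>2)"
    using F finP by (intro sum_mono2) auto
  also have "\<dots> = (\<Sum>u\<in>F \<union> P. tree_weight u * (r u)\<^sup>2
      + of_bool (u \<in> P) * (s\<^sup>2 * tree_weight u - 2 * s * (tree_weight u * r u)))"
    by (intro sum.cong) (auto simp: P_def power2_eq_square algebra_simps)
  also have "\<dots> = (\<Sum>u\<in>F \<union> P. tree_weight u * (r u)\<^sup>2)
      + (\<Sum>u\<in>P. s\<^sup>2 * tree_weight u - 2 * s * (tree_weight u * r u))"
    unfolding sum.distrib
    using F finP by (intro arg_cong2[of _ _ _ _ "(+)"] sum.mono_neutral_cong_right) auto
  also have "(\<Sum>u\<in>P. s\<^sup>2 * tree_weight u - 2 * s * (tree_weight u * r u))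
      = s\<^sup>2 * (\<Sum>u\<in>P. tree_weight u) - 2 * s * tree_sum r x"
    by (simp add: sum_subtractf sum_distrib_left summation_op_def P_def)
  also have "\<dots> \<le> s\<^sup>2 * 2 - 2 * s * tree_sum r x"
    using sum_tree_weight_le[of P x 0] by (auto simp: P_def intro: mult_left_mono)
  finally show "(\<Sum>u\<in>F. tree_weight u * (r u - s * of_bool (prefix u x))\<^sup>2)
      \<le> e - 2 * s * tree_sum r x + 2 * s\<^sup>2"
    using energy_leD[OF assms, of "F \<union> P"] F finP by simp
qed

text \<open>A form of the Cauchy-Schwarz inequality: the quadratic in \<open>s\<close> bounding the
  energy is nonnegative at its minimum \<open>s = tree_sum f x / 2\<close>.\<close>

lemma tree_sum_bound:
  assumes "energy_le f e"
  shows "(tree_sum f x)\<^sup>2 \<le> 2 * e"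
  using energy_le_nonneg[OF energy_le_diff_path[OF assms, of "tree_sum f x / 2" x]]
  by (simp add: power2_eq_square)

lemma abs_tree_sum_le:
  assumes "energy_le f e"
  shows "\<bar>tree_sum f x\<bar> \<le> sqrt (2 * e)"
  using real_sqrt_le_mono[OF tree_sum_bound[OF assms, of x]] by simp

lemma abs_tree_sum_le_2:
  assumes "energy_le g 1"
  shows "\<bar>tree_sum (\<lambda>t. 0 - g t) x\<bar> \<le> 2"
  using abs_tree_sum_le[OF energy_le_scale[OF assms, of "-1"], of x] sqrt2_less_2 by simp

lemma zero_in_dual_ball:
  assumes "0 \<le> b"
  shows "(\<lambda>t. 0) \<in> dual_ball b"
proof -
  have "(\<lambda>t. 0) = dual_summation_op (\<lambda>t. 0)" by (simp add: dual_summation_op_def fun_eq_iff)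
  then show ?thesis using assms by (force simp: dual_ball_def l1_space_def l1_norm_def)
qed

lemma dual_ball_scale:
  assumes "h \<in> dual_ball b" "0 \<le> c"
  shows "(\<lambda>t. c * h t) \<in> dual_ball (c * b)"
proof -
  obtain \<mu> where \<mu>: "\<mu> \<in> l1_space" "l1_norm \<mu> \<le> b" "h = dual_summation_op \<mu>"
    using assms by (auto simp: dual_ball_def)
  have "(\<lambda>t. c * h t) = dual_summation_op (\<lambda>t. c * \<mu> t)"
    by (simp add: \<mu>(3) dual_summation_op_def infsum_cmult_right' fun_eq_iff)
  moreover have "(\<lambda>t. c * \<mu> t) \<in> l1_space"
    using \<mu>(1) assms(2) by (simp add: l1_space_def abs_mult summable_on_cmult_right)
  moreover have "l1_norm (\<lambda>t. c * \<mu> t) \<le> c * b"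
    using \<mu>(2) assms(2) by (simp add: l1_norm_def abs_mult infsum_cmult_right' mult_left_mono)
  ultimately show ?thesis by (auto simp: dual_ball_def)
qed

text \<open>The indicator of the path to \<open>x\<close> is the image of the unit point mass at
  \<open>x\<close>.\<close>

lemma dual_ball_add_path:
  assumes "h \<in> dual_ball b"
  shows "(\<lambda>t. h t + s * of_bool (prefix t x)) \<in> dual_ball (b + \<bar>s\<bar>)"
proof -
  obtain \<mu> where \<mu>: "(\<lambda>t. \<bar>\<mu> t\<bar>) summable_on UNIV" "(\<Sum>\<^sub>\<infinity>t. \<bar>\<mu> t\<bar>) \<le> b" "h = dual_summation_op \<mu>"
    using assms by (auto simp: dual_ball_def l1_space_def l1_norm_def)
  let ?\<delta> = "\<lambda>s u. if u = x then s else 0 :: real"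
  have \<delta>: "(?\<delta> s has_sum s * of_bool (x \<in> A)) A" for s A
    by (rule has_sum_finite_neutralI[of "A \<inter> {x}"]) auto
  have s: "(\<lambda>u. \<bar>\<mu> u\<bar> + ?\<delta> \<bar>s\<bar> u) summable_on UNIV"
    using \<mu>(1) \<delta>[THEN has_sum_imp_summable] by (rule summable_on_add)
  then have s': "(\<lambda>u. \<bar>\<mu> u + ?\<delta> s u\<bar>) summable_on UNIV"
    by (rule summable_on_comparison_test) auto
  have "(\<Sum>\<^sub>\<infinity>u. \<bar>\<mu> u + ?\<delta> s u\<bar>) \<le> (\<Sum>\<^sub>\<infinity>u. \<bar>\<mu> u\<bar> + ?\<delta> \<bar>s\<bar> u)"
    by (rule infsum_mono[OF s' s]) auto
  also have "\<dots> = (\<Sum>\<^sub>\<infinity>u. \<bar>\<mu> u\<bar>) + \<bar>s\<bar>"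
    using infsum_add[OF \<mu>(1) \<delta>[THEN has_sum_imp_summable]] infsumI[OF \<delta>[of "\<bar>s\<bar>" UNIV]] by simp
  finally have norm: "(\<Sum>\<^sub>\<infinity>u. \<bar>\<mu> u + ?\<delta> s u\<bar>) \<le> b + \<bar>s\<bar>" using \<mu>(2) by simp
  have "\<mu> summable_on UNIV" using \<mu>(1) abs_summable_summable[of \<mu> UNIV] by simp
  then have "\<mu> summable_on {u. prefix t u}" for t using summable_on_subset_banach by blast
  then have "dual_summation_op (\<lambda>u. \<mu> u + ?\<delta> s u) t = h t + s * of_bool (prefix t x)" for t
    unfolding dual_summation_op_def \<mu>(3)
    using infsum_add[OF _ \<delta>[THEN has_sum_imp_summable], of \<mu> "{u. prefix t u}" s]
      infsumI[OF \<delta>[of s "{u. prefix t u}"]] by simp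
  then have "(\<lambda>t. h t + s * of_bool (prefix t x)) = dual_summation_op (\<lambda>u. \<mu> u + ?\<delta> s u)" by auto
  then show ?thesis using s' norm unfolding dual_ball_def l1_space_def l1_norm_def by blast
qed

text \<open>
  Greedy algorithm: as long as some \<open>\<bar>tree_sum r x\<bar>\<close> exceeds \<open>c\<close>, subtracting \<open>\<plusminus> c / 2\<close> times the
  indicator of the path to \<open>x\<close> costs \<open>c / 2\<close> of the \<open>\<ell>\<^sub>1\<close>-budget and lowers the energy by at least
  \<open>c\<^sup>2 / 2\<close>.
\<close>

lemma greedy_decomposition:
  assumes "0 < c" "energy_le r e"
  shows "\<exists>h\<in>dual_ball (e / c). \<forall>x. \<bar>tree_sum (\<lambda>t. r t - h t) x\<bar> \<le> c"
proof -
  \<comment> \<open>The number \<open>n\<close> bounds the remaining greedy steps. At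
    \<open>n = 0\<close> no energy is left, so all path sums vanish.\<close>
  have "\<exists>h\<in>dual_ball (e / c). \<forall>x. \<bar>tree_sum (\<lambda>t. r t - h t) x\<bar> \<le> c"
    if "energy_le r e" "e \<le> real n * (c\<^sup>2 / 2)" for n r e
    using that
  proof (induction n arbitrary: r e)
    case 0
    have "e \<le> 0" using 0(2) by simp
    then have "(tree_sum r x)\<^sup>2 \<le> 0" for x
      using tree_sum_bound[OF 0(1), of x] by linarith
    then have "tree_sum r x = 0" for x by simp
    moreover have "(\<lambda>t. 0) \<in> dual_ball (e / c)"
      using energy_le_nonneg[OF 0(1)] assms(1) by (intro zero_in_dual_ball) simp
    ultimately show ?case using assms(1) by (intro bexI[of _ "\<lambda>t. 0"]) auto
  next
    case (Suc n)
    show ?case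
    proof (cases "\<forall>x. \<bar>tree_sum r x\<bar> \<le> c")
      case True
      moreover have "(\<lambda>t. 0) \<in> dual_ball (e / c)"
        using energy_le_nonneg[OF Suc.prems(1)] assms(1) by (intro zero_in_dual_ball) simp
      ultimately show ?thesis by (intro bexI[of _ "\<lambda>t. 0"]) auto
    next
      case False
      then obtain x where x: "c < \<bar>tree_sum r x\<bar>" by (auto simp: not_le)
      define s where "s = sgn (tree_sum r x) * (c / 2)"
      have "0 \<noteq> tree_sum r x" using x assms(1) by auto
      then have s: "\<bar>s\<bar> = c / 2"
        using assms(1) by (simp add: s_def abs_mult abs_sgn_eq)
      have sV: "2 * s * tree_sum r x = c * \<bar>tree_sum r x\<bar>"
        by (simp add: s_def abs_sgn)
      from s have "s\<^sup>2 = (c / 2)\<^sup>2" by (metis power2_abs)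
      moreover have "c * c \<le> c * \<bar>tree_sum r x\<bar>" using x assms(1) by simp
      ultimately have "e - 2 * s * tree_sum r x + 2 * s\<^sup>2 \<le> e - c\<^sup>2 / 2"
        using sV by (simp add: power2_eq_square)
      with energy_le_diff_path[OF Suc.prems(1)]
      have "energy_le (\<lambda>u. r u - s * of_bool (prefix u x)) (e - c\<^sup>2 / 2)" by (rule energy_le_mono)
      moreover have "e - c\<^sup>2 / 2 \<le> real n * (c\<^sup>2 / 2)" using Suc.prems(2) by (simp add: algebra_simps)
      ultimately obtain h where h: "h \<in> dual_ball ((e - c\<^sup>2 / 2) / c)"
        "\<And>y. \<bar>tree_sum (\<lambda>u. r u - s * of_bool (prefix u x) - h u) y\<bar> \<le> c"
        using Suc.IH by blast
      \<comment> \<open>The budget balances exactly: the energy drop \<open>c\<^sup>2 / 2\<close>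
        divided by \<open>c\<close> equals the amount \<open>c / 2\<close> spent.\<close>
      have "(e - c\<^sup>2 / 2) / c + \<bar>s\<bar> = e / c"
        using assms(1) s by (simp add: field_simps power2_eq_square)
      then have "(\<lambda>u. h u + s * of_bool (prefix u x)) \<in> dual_ball (e / c)"
        using dual_ball_add_path[OF h(1), of s x] by simp
      then show ?thesis
        using h(2) by (intro bexI[of _ "\<lambda>u. h u + s * of_bool (prefix u x)"]) (auto simp: algebra_simps)
    qed
  qed
  moreover obtain n where "e < real n * (c\<^sup>2 / 2)"
    using reals_Archimedean3[of "c\<^sup>2 / 2"] assms(1) by auto
  ultimately show ?thesis using assms(2) less_imp_le by blast
qed

text \<open>
  Duality of covering numbers: write \<open>g = h + r\<close> as in the greedy decomposition, cover \<open>h\<close> in the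
  energy norm, and cover the rescaled remainder of that covering at the next coarser scale.
\<close>

lemma tree_sum_dyadic_covering:
  "\<exists>Z. finite Z \<and> Z \<subseteq> l2_space tree_weight \<and> real (card Z) \<le> exp (12800 * 4 ^ j)
    \<and> (\<forall>g. energy_le g 1 \<longrightarrow> (\<exists>z\<in>Z. \<forall>x. \<bar>tree_sum (\<lambda>t. z t - g t) x\<bar> \<le> 2 / 2 ^ j))"
proof (induction j)
  case 0
  show ?case
    using abs_tree_sum_le_2 energy_le_imp(1)[OF energy_le_zero] by (intro exI[of _ "{\<lambda>t. 0}"]) auto
next
  case (Suc j)
  then obtain Z where Z: "finite Z" "Z \<subseteq> l2_space tree_weight" "real (card Z) \<le> exp (12800 * 4 ^ j)"
    "\<And>g. energy_le g 1 \<Longrightarrow> \<exists>z\<in>Z. \<forall>x. \<bar>tree_sum (\<lambda>t. z t - g t) x\<bar> \<le> 2 / 2 ^ j"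
    by blast
  \<comment> \<open>Half of the new radius \<open>2 / 2 ^ Suc j\<close>; the other half is the old
    radius \<open>2 / 2 ^ j\<close> scaled by \<open>1 / 4\<close>.\<close>
  define c :: real where "c = 1 / (2 * 2 ^ j)"
  have c: "0 < c" by (simp add: c_def)
  obtain S where S: "finite S" "S \<subseteq> l2_space tree_weight" "real (card S) \<le> exp (600 / (c / 4)\<^sup>2)"
    "\<And>h. h \<in> dual_ball 1 \<Longrightarrow> \<exists>y\<in>S. energy_le (\<lambda>t. y t - h t) ((c / 4)\<^sup>2)"
    using dual_ball_covering[of "c / 4"] c by auto
  define f where "f = (\<lambda>(y, z) (t::node). y t / c + (z t :: real) / 4)"
  have "real (card (f ` (S \<times> Z))) \<le> real (card S) * real (card Z)"
    using card_image_le[of "S \<times> Z" f] S(1) Z(1)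
    by (simp add: card_cartesian_product flip: of_nat_mult)
  also have "\<dots> \<le> exp (600 / (c / 4)\<^sup>2) * exp (12800 * 4 ^ j)"
    using S(3) Z(3) by (intro mult_mono) auto
  also have "600 / (c / 4)\<^sup>2 = 38400 * (2 ^ j)\<^sup>2" by (simp add: c_def field_simps)
  also have "(2 ^ j)\<^sup>2 = (4::real) ^ j" by (simp add: power2_eq_square flip: power_mult_distrib)
  \<comment> \<open>The constant 12800 solves \<open>38400 + A = 4 * A\<close>, so the geometric
    growth absorbs the cost of each level.\<close>
  finally have card: "real (card (f ` (S \<times> Z))) \<le> exp (12800 * 4 ^ Suc j)"
    by (simp add: exp_add[symmetric])
  have cover: "\<exists>w\<in>f ` (S \<times> Z). \<forall>x. \<bar>tree_sum (\<lambda>t. w t - g t) x\<bar> \<le> 2 / 2 ^ Suc j"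
    if g: "energy_le g 1" for g
  proof -
    obtain h where h: "h \<in> dual_ball (1 / c)" "\<And>x. \<bar>tree_sum (\<lambda>t. g t - h t) x\<bar> \<le> c"
      using greedy_decomposition[OF c g] by blast
    have "(\<lambda>t. c * h t) \<in> dual_ball 1" using dual_ball_scale[OF h(1), of c] c by simp
    then obtain y where y: "y \<in> S" "energy_le (\<lambda>t. y t - c * h t) ((c / 4)\<^sup>2)" using S(4) by blast
    \<comment> \<open>The covering error \<open>h - y / c\<close> equals \<open>b / 4\<close>, where
      \<open>b\<close> has energy at most 1. Approximating \<open>b\<close> by \<open>z\<close> from
      the coarser covering yields the centre \<open>y / c + z / 4\<close>.\<close>
    define b where "b = (\<lambda>t. - (4 / c) * (y t - c * h t))"
    have "energy_le b ((- (4 / c))\<^sup>2 * (c / 4)\<^sup>2)" unfolding b_def using y(2) by (rule energy_le_scale)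
    then have "energy_le b 1" using c by (simp add: power_divide)
    then obtain z where z: "z \<in> Z" "\<And>x. \<bar>tree_sum (\<lambda>t. z t - b t) x\<bar> \<le> 2 / 2 ^ j" using Z(4) by blast
    have "\<bar>tree_sum (\<lambda>t. f (y, z) t - g t) x\<bar> \<le> 2 / 2 ^ Suc j" for x
    proof -
      have "(\<lambda>t. f (y, z) t - g t) = (\<lambda>t. 1 / 4 * (z t - b t) - (g t - h t))"
        using c by (simp add: f_def b_def fun_eq_iff field_simps)
      then have "tree_sum (\<lambda>t. f (y, z) t - g t) x
          = 1 / 4 * tree_sum (\<lambda>t. z t - b t) x - tree_sum (\<lambda>t. g t - h t) x"
        by (simp only: tree_sum_diff[of "\<lambda>t. 1 / 4 * (z t - b t)"] tree_sum_scale)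
      then have "\<bar>tree_sum (\<lambda>t. f (y, z) t - g t) x\<bar> \<le> 1 / 4 * (2 / 2 ^ j) + c"
        using z(2)[of x] h(2)[of x] by linarith
      also have "\<dots> = 2 / 2 ^ Suc j" by (simp add: c_def field_simps)
      finally show ?thesis .
    qed
    then show ?thesis using y(1) z(1) by blast
  qed
  have "f ` (S \<times> Z) \<subseteq> l2_space tree_weight"
  proof clarify
    fix y z assume "y \<in> S" "z \<in> Z"
    then obtain r s where "energy_le y r" "energy_le z s"
      using S(2) Z(2) l2_space_imp_energy_le by (metis subsetD)
    from energy_le_add[OF energy_le_scale[OF this(1), of "1 / c"] energy_le_scale[OF this(2), of "1 / 4"]]
    show "f (y, z) \<in> l2_space tree_weight" unfolding f_def by (auto dest: energy_le_imp(1))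
  qed
  then show ?case using card cover S(1) Z(1) by (intro exI[of _ "f ` (S \<times> Z)"]) auto
qed

text \<open>The dyadic covering is used for the least \<open>j\<close> with
  \<open>2 / 2 ^ j \<le> \<rho>\<close>. Minimality gives \<open>\<rho> * 2 ^ j \<le> 4\<close>,
  hence \<open>4 ^ j \<le> 16 / \<rho>\<^sup>2\<close>, and
  \<open>12800 * 16 = 204800\<close>.\<close>

lemma tree_sum_covering:
  fixes \<rho> :: real
  assumes "0 < \<rho>"
  shows "\<exists>Z. finite Z \<and> Z \<subseteq> l2_space tree_weight \<and> real (card Z) \<le> exp (204800 / \<rho>\<^sup>2)
    \<and> (\<forall>g. energy_le g 1 \<longrightarrow> (\<exists>z\<in>Z. \<forall>x. \<bar>tree_sum (\<lambda>t. z t - g t) x\<bar> \<le> \<rho>))"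
proof (cases "2 \<le> \<rho>")
  case True
  have "\<bar>tree_sum (\<lambda>t. 0 - g t) x\<bar> \<le> \<rho>" if "energy_le g 1" for g x
    using abs_tree_sum_le_2[OF that] True by (rule order_trans)
  then show ?thesis
    using energy_le_imp(1)[OF energy_le_zero] by (intro exI[of _ "{\<lambda>t. 0}"]) auto
next
  case False
  define P where "P = (\<lambda>j::nat. 2 / 2 ^ j \<le> \<rho>)"
  obtain i where "(1 / 2) ^ i < \<rho> / 2" using real_arch_pow_inv[of "\<rho> / 2" "1 / 2"] assms by auto
  then have "P i" by (simp add: P_def power_divide field_simps)
  define j where "j = (LEAST j. P j)"
  have j: "P j" unfolding j_def using \<open>P i\<close> by (rule LeastI)
  have "\<not> P 0" using False by (simp add: P_def)
  then obtain l where l: "j = Suc l" using j by (cases j) auto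
  have "\<not> P l" using not_less_Least[of l P] l by (simp add: j_def)
  then have "\<rho> * 2 ^ j \<le> 4" by (simp add: P_def l field_simps)
  then have "(\<rho> * 2 ^ j)\<^sup>2 \<le> 4\<^sup>2" using assms by (intro power_mono) auto
  moreover have "(2 ^ j)\<^sup>2 = (4::real) ^ j" by (simp add: power2_eq_square flip: power_mult_distrib)
  ultimately have "12800 * 4 ^ j \<le> 204800 / \<rho>\<^sup>2"
    using assms by (simp add: power_mult_distrib field_simps)
  then have "exp (12800 * 4 ^ j) \<le> exp (204800 / \<rho>\<^sup>2)" by simp
  then show ?thesis
    using tree_sum_dyadic_covering[of j] j unfolding P_def by (meson order_trans)
qed

section \<open>From covering numbers to entropy numbers\<close>

lemma entropy_number_le:
  fixes n :: nat
  assumes C: "0 < C" and n: "1 \<le> n"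
    and cover: "\<And>\<rho>::real. 0 < \<rho> \<Longrightarrow> \<exists>S. finite S \<and> S \<subseteq> M \<and> real (card S) \<le> exp (C / \<rho>\<^sup>2)
      \<and> (\<forall>y\<in>A. y \<in> M \<and> (\<exists>c\<in>S. d c y \<le> \<rho>))"
  shows "entropy_number M d n A \<le> ereal (sqrt (2 * C / ln 2) / sqrt (real n))"
proof -
  define \<rho> where "\<rho> = sqrt (2 * C / ln 2) / sqrt (real n)"
  have \<rho>: "0 < \<rho>" using C n by (simp add: \<rho>_def)
  \<comment> \<open>The radius is chosen to allow \<open>2 powr (n / 2)\<close> centres, which is at
    most \<open>2 ^ (n - 1)\<close> for \<open>n \<ge> 2\<close>.\<close>
  have "C / \<rho>\<^sup>2 = real n / 2 * ln 2" using C n by (simp add: \<rho>_def power_divide)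
  then have exp: "exp (C / \<rho>\<^sup>2) = 2 powr (real n / 2)" by (simp add: powr_def)
  obtain S where S: "finite S" "S \<subseteq> M" "real (card S) \<le> 2 powr (real n / 2)"
    "\<And>y. y \<in> A \<Longrightarrow> y \<in> M \<and> (\<exists>c\<in>S. d c y \<le> \<rho>)"
    using cover[OF \<rho>] unfolding exp by blast
  have "card S \<le> 2 ^ (n - 1)"
  \<comment> \<open>For \<open>n = 1\<close> the exponent \<open>n / 2\<close> exceeds
    \<open>n - 1 = 0\<close>, but a cardinality below 2 is at most 1.\<close>
  proof (cases "n = 1")
    case True
    then have "real (card S) \<le> 2 powr (1 / 2)" using S(3) by simp
    also have "\<dots> < 2 powr 1" by (intro powr_less_mono) auto
    finally show ?thesis using True by simp
  next
    case False
    then have "real (card S) \<le> 2 powr real (n - 1)"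
      using S(3) n by (elim order_trans) (intro powr_mono, auto)
    also have "\<dots> = real (2 ^ (n - 1))" by (simp add: powr_realpow)
    finally show ?thesis by (simp only: of_nat_le_iff)
  qed
  moreover have "A \<subseteq> (\<Union>c\<in>S. {y \<in> M. d c y \<le> \<rho>})" using S(4) by blast
  ultimately show ?thesis
    unfolding entropy_number_def \<rho>_def[symmetric] using S(1,2) \<rho>
    by (intro Inf_lower) blast
qed

lemma linf_space_tree_sum:
  assumes "energy_le f e"
  shows "tree_sum f \<in> linf_space"
  unfolding linf_space_def bounded_iff using abs_tree_sum_le[OF assms] by auto

theorem theorem2:
  shows "\<exists>C::real. \<forall>n::nat. n \<ge> 1 \<longrightarrow>
    max (operator_entropy_number (l2_space tree_weight) (l2_norm tree_weight)
           linf_space linf_norm n (summation_op tree_weight))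
        (operator_entropy_number l1_space l1_norm
           (l2_space tree_weight) (l2_norm tree_weight) n dual_summation_op)
      \<le> ereal (C / sqrt (real n))"
proof (rule exI[of _ "sqrt (2 * 204800 / ln 2)"], intro allI impI)
  fix n :: nat assume n: "1 \<le> n"
  \<comment> \<open>The exponent constant for the operator; it exceeds the 600 of the dual, so one
    constant serves both bounds.\<close>
  let ?C = "204800 :: real"
  have "operator_entropy_number (l2_space tree_weight) (l2_norm tree_weight)
           linf_space linf_norm n tree_sum \<le> ereal (sqrt (2 * ?C / ln 2) / sqrt (real n))"
    unfolding operator_entropy_number_def
  proof (rule entropy_number_le[OF _ n])
    fix \<rho> :: real assume \<rho>: "0 < \<rho>"
    obtain Z where Z: "finite Z" "Z \<subseteq> l2_space tree_weight" "real (card Z) \<le> exp (?C / \<rho>\<^sup>2)"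
      "\<And>g. energy_le g 1 \<Longrightarrow> \<exists>z\<in>Z. \<forall>x. \<bar>tree_sum (\<lambda>t. z t - g t) x\<bar> \<le> \<rho>"
      using tree_sum_covering[OF \<rho>] by blast
    have "tree_sum ` Z \<subseteq> linf_space"
      using Z(2) l2_space_imp_energy_le linf_space_tree_sum by (intro image_subsetI) (meson subsetD)
    moreover have "real (card (tree_sum ` Z)) \<le> exp (?C / \<rho>\<^sup>2)"
      using Z(3) card_image_le[OF Z(1), of tree_sum] by simp
    moreover have "tree_sum g \<in> linf_space \<and> (\<exists>c\<in>tree_sum ` Z. linf_norm (\<lambda>t. c t - tree_sum g t) \<le> \<rho>)"
      if "g \<in> l2_space tree_weight" "l2_norm tree_weight g \<le> 1" for g
    proof -
      have g: "energy_le g 1" using l2_norm_le_imp_energy_le[OF that] by simp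
      then obtain z where z: "z \<in> Z" "\<And>x. \<bar>tree_sum (\<lambda>t. z t - g t) x\<bar> \<le> \<rho>" using Z(4) by blast
      have "linf_norm (\<lambda>t. tree_sum z t - tree_sum g t) \<le> \<rho>"
        unfolding linf_norm_def using z(2) by (intro cSUP_least) (auto simp: tree_sum_diff)
      then show ?thesis using z(1) linf_space_tree_sum[OF g] by blast
    qed
    ultimately show "\<exists>S. finite S \<and> S \<subseteq> linf_space \<and> real (card S) \<le> exp (?C / \<rho>\<^sup>2)
        \<and> (\<forall>y\<in>tree_sum ` {f \<in> l2_space tree_weight. l2_norm tree_weight f \<le> 1}.
             y \<in> linf_space \<and> (\<exists>c\<in>S. linf_norm (\<lambda>t. c t - y t) \<le> \<rho>))"
      using Z(1) by (intro exI[of _ "tree_sum ` Z"]) (simp add: ball_simps)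
  qed simp
  moreover have "operator_entropy_number l1_space l1_norm (l2_space tree_weight) (l2_norm tree_weight)
      n dual_summation_op \<le> ereal (sqrt (2 * ?C / ln 2) / sqrt (real n))"
    unfolding operator_entropy_number_def
  proof (rule entropy_number_le[OF _ n])
    fix \<rho> :: real assume \<rho>: "0 < \<rho>"
    obtain S where S: "finite S" "S \<subseteq> l2_space tree_weight" "real (card S) \<le> exp (600 / \<rho>\<^sup>2)"
      "\<And>h. h \<in> dual_ball 1 \<Longrightarrow> \<exists>c\<in>S. energy_le (\<lambda>t. c t - h t) (\<rho>\<^sup>2)"
      using dual_ball_covering[OF \<rho>] by blast
    have "real (card S) \<le> exp (?C / \<rho>\<^sup>2)"
      by (rule order_trans[OF S(3)]) (simp add: divide_right_mono)
    moreover have "h \<in> l2_space tree_weight \<and> (\<exists>c\<in>S. l2_norm tree_weight (\<lambda>t. c t - h t) \<le> \<rho>)"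
      if h: "h \<in> dual_ball 1" for h
    proof -
      obtain c where c: "c \<in> S" "energy_le (\<lambda>t. c t - h t) (\<rho>\<^sup>2)" using S(4)[OF h] by blast
      have "l2_norm tree_weight (\<lambda>t. c t - h t) \<le> \<rho>" using energy_le_imp(2)[OF c(2)] \<rho> by simp
      then show ?thesis using c(1) energy_le_imp(1)[OF energy_le_dual_ball[OF h]] by blast
    qed
    moreover have "dual_summation_op ` {f \<in> l1_space. l1_norm f \<le> 1} = dual_ball 1"
      by (auto simp: dual_ball_def)
    ultimately show "\<exists>S. finite S \<and> S \<subseteq> l2_space tree_weight \<and> real (card S) \<le> exp (?C / \<rho>\<^sup>2)
        \<and> (\<forall>y\<in>dual_summation_op ` {f \<in> l1_space. l1_norm f \<le> 1}.
             y \<in> l2_space tree_weight \<and> (\<exists>c\<in>S. l2_norm tree_weight (\<lambda>t. c t - y t) \<le> \<rho>))"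
      using S(1,2) by (intro exI[of _ S]) simp
  qed simp
  ultimately show "max (operator_entropy_number (l2_space tree_weight) (l2_norm tree_weight)
           linf_space linf_norm n tree_sum)
        (operator_entropy_number l1_space l1_norm
           (l2_space tree_weight) (l2_norm tree_weight) n dual_summation_op)
      \<le> ereal (sqrt (2 * ?C / ln 2) / sqrt (real n))" by (rule max.boundedI)
qed

end
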